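(* Let $k_0\ge 1$ be an integer, let $0\le t_1<\cdots<t_{k_0}<2\pi$, and extend these times $2\pi$-periodically, so that $t_{j+k_0}=t_j+2\pi$ for all $j$. Let $a>0$ be a constant. Let $p:\mathbb{R}\times\mathbb{R}\times\mathbb{R}\to\mathbb{R}$ be bounded, continuous and $2\pi$-periodic in its first variable. Let $g:\mathbb{R}\to\mathbb{R}$ be locally Lipschitz continuous and differentiable, put $G(x)=\int_0^x g(s)\,ds$, and suppose that $$(g_0)\quad \lim_{|x|\to+\infty}\frac{g(x)}{x}=0,$$ $$(g_1)\quad \lim_{|x|\to+\infty} g(x)\,\mathrm{sign}(x)=+\infty,\qquad \lim_{x^+\to+\infty}\int_{x^-}^{x^+}\frac{ds}{\sqrt{G(x^+)-G(s)}}=+\infty,$$ where $x^-<0<x^+$ satisfy $G(x^-)=G(x^+)$, and $$(g_2)\quad g'(x)>0\quad\text{for all }x\in\mathbb{R}.$$ Then there is a sequence of positive integers $0<n_1<n_2<\cdots<n_k<\cdots\to\infty$ such that, for each $k=1,2,\dots$, the impulsive differential equation $$x''(t)+g(x)=p(t,x,x'),\quad t\ne t_j;\qquad \Delta x|_{t=t_j}=a\,x(t_j-),\quad \Delta x'|_{t=t_j}=a\,x'(t_j-)\quad\text{for all } j,$$ has at least one $2n_k\pi$-periodic solution.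
   Context: The index $j$ of the impulse times runs over all indices of the bi-infinite periodic sequence $(t_j)$. Notation: $\Delta x|_{t=t_j}=x(t_j+)-x(t_j-)$ and $\Delta x'|_{t=t_j}=x'(t_j+)-x'(t_j-)$, where $\pm$ denote one-sided limits. A solution satisfies the differential equation away from the impulse times and the jump conditions at the impulse times; by convention its values at $t_j$ are the left limits, $x(t_j)=x(t_j-)$ and $x'(t_j)=x'(t_j-)$. In $(g_1)$, for $x^+$ large, $x^-$ is the negative number with $G(x^-)=G(x^+)$. *)

theory Defs
  imports "HOL-Analysis.Analysis"
begin

definition primitive :: "(real \<Rightarrow> real) \<Rightarrow> real \<Rightarrow> real" where
  "primitive g x = (LBINT s=ereal 0..ereal x. g s)"

text \<open>
  The point \<open>x\<^sup>-\<close> belonging to \<open>x\<^sup>+\<close>. When \<open>g x * sgn x\<close> tends to infinity as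
  \<open>\<bar>x\<bar>\<close> does, it exists and is unique for all sufficiently large \<open>x\<^sup>+\<close>, so the description is
  used only in a limit at infinity.
\<close>
definition conj_point :: "(real \<Rightarrow> real) \<Rightarrow> real \<Rightarrow> real" where
  "conj_point g xp = (THE xm. xm < 0 \<and> primitive g xm = primitive g xp)"

text \<open>
  Solutions on the whole line of \<open>x'' + g(x) = p(t, x, x')\<close> with jumps \<open>a x\<close> and \<open>a x'\<close> at the
  impulse times \<open>\<tau> j\<close>. The function \<open>v\<close> is \<open>x'\<close>, extended to the impulse times by its left
  limits; the values of \<open>x\<close> at impulse times are left limits too. The limits \<open>xr\<close> and \<open>vr\<close> are
  \<open>x(t\<^sub>j+)\<close> and \<open>x'(t\<^sub>j+)\<close>.
\<close>
definition impulsive_solution ::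
  "(int \<Rightarrow> real) \<Rightarrow> real \<Rightarrow> (real \<Rightarrow> real) \<Rightarrow> (real \<times> real \<times> real \<Rightarrow> real) \<Rightarrow> (real \<Rightarrow> real) \<Rightarrow> bool"
where
  "impulsive_solution \<tau> a g p x \<longleftrightarrow> (\<exists>v.
     (\<forall>t. t \<notin> range \<tau> \<longrightarrow>
        (x has_real_derivative v t) (at t) \<and>
        (\<exists>w. (v has_real_derivative w) (at t) \<and> w + g (x t) = p (t, x t, v t))) \<and>
     (\<forall>j. (x \<longlongrightarrow> x (\<tau> j)) (at_left (\<tau> j)) \<and> (v \<longlongrightarrow> v (\<tau> j)) (at_left (\<tau> j)) \<and>
        (\<exists>xr vr. (x \<longlongrightarrow> xr) (at_right (\<tau> j)) \<and> (v \<longlongrightarrow> vr) (at_right (\<tau> j)) \<and>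
           xr - x (\<tau> j) = a * x (\<tau> j) \<and> vr - v (\<tau> j) = a * v (\<tau> j))))"

end

theory Submission
  imports Defs "HOL-Complex_Analysis.Great_Picard"
begin

text \<open>
  There is even a solution of the basic period \<open>2\<pi>\<close>, so \<open>n\<^sub>k = k + 1\<close> will do. The reason is that
  the impulses expand: they multiply the whole state \<open>(x, x')\<close> by \<open>b = 1 + a > 1\<close>, hence by
  \<open>c = b ^ k0 > 1\<close> over a period. Let \<open>M t\<close> be \<open>b\<close> to the number of impulses before \<open>t\<close>, counted
  from the start of a period. Then \<open>u = x / M\<close> has no jumps: it satisfies
  \<open>u'' = (p(t, M u, M u') - g(M u)) / M\<close> away from the impulses, \<open>u\<close> and \<open>u'\<close> are continuous,
  and \<open>x\<close> is periodic precisely if \<open>(u, u')\<close> is divided by \<open>c\<close> in each period.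

  For \<open>u'' = h\<close> with \<open>h\<close> bounded by \<open>B\<close>, the multiplier condition \<open>u(t0) = c u(t0 + T)\<close>,
  \<open>u'(t0) = c u'(t0 + T)\<close> can be solved for the initial values, because \<open>c \<noteq> 1\<close>, and it bounds
  the solution by \<open>K B\<close> with \<open>K\<close> depending only on \<open>c\<close> and \<open>T\<close>. As \<open>g\<close> is sublinear, a truncation
  of \<open>g\<close> outside \<open>[-r, r]\<close> makes \<open>B\<close> as small as \<open>\<epsilon> r + C\<close>. If \<open>r\<close> is suitably large, the solution
  of the truncated problem stays within \<open>[-r, r]\<close> and solves the original problem
  (\<open>sublinear_multiplier_problem\<close>).

  The right-hand side is merely continuous in the state, so solutions of initial value problems
  need not be unique and there is no Poincare map. The bounded problem
  (\<open>bounded_multiplier_problem\<close>) is solved with Euler polygons instead: a polygon depends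
  continuously on its initial point, so Brouwer's theorem in the plane yields polygons with the exact
  multiplier condition (\<open>euler_closed_orbit\<close>), and the Arzela-Ascoli theorem yields a limit, which
  solves the equation wherever the right-hand side is continuous (\<open>euler_polygons_converge\<close>).
\<close>

section \<open>Euler polygons and their limits\<close>

primrec euler_node ::
  "(real \<Rightarrow> 'a \<Rightarrow> 'a::real_normed_vector) \<Rightarrow> real \<Rightarrow> real \<Rightarrow> 'a \<Rightarrow> nat \<Rightarrow> 'a"
where
  "euler_node F t0 h z 0 = z"
| "euler_node F t0 h z (Suc k) =
     euler_node F t0 h z k + h *\<^sub>R F (t0 + real k * h) (euler_node F t0 h z k)"

text \<open>
  The length of the part of the \<open>k\<close>-th step interval that lies before \<open>t\<close>. With these weights a
  polygon becomes one finite sum, whose increments are controlled by telescoping instead of by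
  locating \<open>t\<close> among the nodes.
\<close>

definition ramp :: "real \<Rightarrow> real \<Rightarrow> nat \<Rightarrow> real \<Rightarrow> real" where
  "ramp t0 h k t = min (t0 + real (Suc k) * h) t - min (t0 + real k * h) t"

definition euler_polygon ::
  "(real \<Rightarrow> 'a \<Rightarrow> 'a::real_normed_vector) \<Rightarrow> real \<Rightarrow> real \<Rightarrow> nat \<Rightarrow> 'a \<Rightarrow> real \<Rightarrow> 'a"
where
  "euler_polygon F t0 h N z t =
     z + (\<Sum>k<N. ramp t0 h k t *\<^sub>R F (t0 + real k * h) (euler_node F t0 h z k))"

lemma sum_ramp: "(\<Sum>k<N. ramp t0 h k t) = min (t0 + real N * h) t - min t0 t"
  unfolding ramp_def by (subst sum_lessThan_telescope) simp

lemma ramp_mono: "0 \<le> h \<Longrightarrow> s \<le> t \<Longrightarrow> ramp t0 h k s \<le> ramp t0 h k t"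
  unfolding ramp_def by (auto simp: min_def algebra_simps)

lemma ramp_eq_outside:
  assumes "0 \<le> h" "s \<le> t" "t \<le> t0 + real k * h \<or> t0 + real k * h \<le> s - h"
  shows "ramp t0 h k s = ramp t0 h k t"
  using assms unfolding ramp_def by (auto simp: min_def algebra_simps)

lemma ramp_at_node:
  assumes "0 \<le> h"
  shows "ramp t0 h k (t0 + real i * h) = (if k < i then h else 0)"
proof (cases "k < i")
  case True
  then have "real (Suc k) * h \<le> real i * h" "real k * h \<le> real i * h"
    using assms by (auto intro!: mult_right_mono)
  with True show ?thesis by (simp add: ramp_def algebra_simps)
next
  case False
  then have "real i * h \<le> real k * h" "real i * h \<le> real (Suc k) * h"
    using assms by (auto intro!: mult_right_mono)
  with False show ?thesis by (simp add: ramp_def)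
qed

lemma euler_node_eq_sum:
  "euler_node F t0 h z i = z + (\<Sum>k<i. h *\<^sub>R F (t0 + real k * h) (euler_node F t0 h z k))"
  by (induction i) (simp_all add: algebra_simps)

lemma euler_polygon_at_node:
  assumes "0 \<le> h" "i \<le> N"
  shows "euler_polygon F t0 h N z (t0 + real i * h) = euler_node F t0 h z i"
proof -
  have "(\<Sum>k<N. (if k < i then h else 0) *\<^sub>R F (t0 + real k * h) (euler_node F t0 h z k))
      = (\<Sum>k<i. h *\<^sub>R F (t0 + real k * h) (euler_node F t0 h z k))"
    using assms by (intro sum.mono_neutral_cong_right) auto
  then show ?thesis
    unfolding euler_polygon_def ramp_at_node[OF assms(1)] by (simp add: euler_node_eq_sum[symmetric])
qed

text \<open>
  The weights increase with \<open>t\<close> and add up to \<open>t - t0\<close>, so the mean slope between \<open>s\<close> and \<open>t\<close> is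
  an average of the slopes of the steps that meet \<open>(s, t)\<close>. With \<open>w = 0\<close> this gives a
  Lipschitz bound, and with \<open>w\<close> the slope expected at a point it gives differentiability of limits.
\<close>

lemma euler_polygon_increment:
  assumes h: "0 \<le> h" and st: "t0 \<le> s" "s \<le> t" "t \<le> t0 + real N * h"
    and e: "\<And>k. k < N \<Longrightarrow> s - h < t0 + real k * h \<Longrightarrow> t0 + real k * h < t \<Longrightarrow>
      norm (F (t0 + real k * h) (euler_node F t0 h z k) - w) \<le> e"
  shows "norm (euler_polygon F t0 h N z t - euler_polygon F t0 h N z s - (t - s) *\<^sub>R w) \<le> e * (t - s)"
proof -
  define d where "d = (\<lambda>k. ramp t0 h k t - ramp t0 h k s)"
  define f where "f = (\<lambda>k. F (t0 + real k * h) (euler_node F t0 h z k))"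
  have dsum: "(\<Sum>k<N. d k) = t - s"
    unfolding d_def using st by (simp add: sum_subtractf sum_ramp)
  have "euler_polygon F t0 h N z t - euler_polygon F t0 h N z s - (t - s) *\<^sub>R w
      = (\<Sum>k<N. d k *\<^sub>R (f k - w))"
    unfolding dsum[symmetric] euler_polygon_def
    by (simp add: d_def f_def scaleR_diff_right scaleR_diff_left sum_subtractf scaleR_left.sum
        sum.distrib algebra_simps)
  also have "norm \<dots> \<le> (\<Sum>k<N. d k * e)"
  proof (rule sum_norm_le)
    fix k assume k: "k \<in> {..<N}"
    have d0: "0 \<le> d k" using ramp_mono[OF h st(2)] by (simp add: d_def)
    show "norm (d k *\<^sub>R (f k - w)) \<le> d k * e"
    proof (cases "s - h < t0 + real k * h \<and> t0 + real k * h < t")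
      case True
      then have "norm (f k - w) \<le> e" using e k by (simp add: f_def)
      then show ?thesis using d0 by (simp add: mult_left_mono)
    next
      case False
      then have "d k = 0" using ramp_eq_outside[OF h st(2)] by (force simp: d_def)
      then show ?thesis by simp
    qed
  qed
  also have "\<dots> = e * (t - s)" by (simp add: sum_distrib_right[symmetric] dsum)
  finally show ?thesis .
qed

text \<open>
  The polygons are uniformly Lipschitz, so a subsequence converges uniformly by Arzela-Ascoli. At a
  continuity point of \<open>F\<close> on the graph of the limit, all slopes that the polygons use nearby are
  close to the expected one, and the increment estimate survives the limit.
\<close>

lemma euler_polygons_converge:
  fixes F :: "real \<Rightarrow> 'a::euclidean_space \<Rightarrow> 'a" and z :: "nat \<Rightarrow> 'a" and h :: "nat \<Rightarrow> real"
  assumes T: "0 < T" and h_def: "\<And>n. h n = T / real (Suc n)"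
    and start: "\<And>n. norm (z n) \<le> R"
    and slope: "\<And>n k. k \<le> n \<Longrightarrow> norm (F (t0 + real k * h n) (euler_node F t0 (h n) (z n) k)) \<le> L"
  obtains w r where "strict_mono (r :: nat \<Rightarrow> nat)" "continuous_on {t0..t0+T} w"
    "\<And>t. t \<in> {t0..t0+T} \<Longrightarrow>
       (\<lambda>n. euler_polygon F t0 (h (r n)) (Suc (r n)) (z (r n)) t) \<longlonglongrightarrow> w t"
    "\<And>t. t \<in> {t0<..<t0+T} \<Longrightarrow> isCont (\<lambda>(s, y). F s y) (t, w t) \<Longrightarrow>
       (w has_vector_derivative F t (w t)) (at t)"
    "\<And>t. t \<in> {t0..t0+T} \<Longrightarrow> norm (w t) \<le> R + L * T"
proof -
  define W where "W = (\<lambda>n. euler_polygon F t0 (h n) (Suc n) (z n))"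
  have h0: "0 < h n" for n unfolding h_def using T by simp
  have hT: "real (Suc n) * h n = T" for n unfolding h_def by simp
  have L0: "0 \<le> L" using slope[of 0 0] norm_ge_zero order_trans by blast
  have incr: "norm (W n t - W n s) \<le> L * (t - s)" if "t0 \<le> s" "s \<le> t" "t \<le> t0 + T" for n s t
    using euler_polygon_increment[where F = F and h = "h n" and N = "Suc n" and z = "z n" and w = 0
        and e = L, of t0 s t] slope[of _ n] that h0[of n] hT[of n]
    by (simp add: W_def less_imp_le)
  have lip: "norm (W n s - W n t) \<le> L * norm (s - t)"
    if "s \<in> {t0..t0+T}" "t \<in> {t0..t0+T}" for n s t
    using incr[of s t n] incr[of t s n] that
    by (cases "s \<le> t") (auto simp: norm_minus_commute)
  have W0: "W n t0 = z n" for n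
    using euler_polygon_at_node[of "h n" 0 "Suc n" F t0 "z n"] h0[of n] by (simp add: W_def)
  have bound: "norm (W n t) \<le> R + L * T" if "t \<in> {t0..t0+T}" for n t
  proof -
    have "norm (W n t) \<le> norm (W n t0) + norm (W n t - W n t0)"
      using norm_triangle_ineq[of "W n t0" "W n t - W n t0"] by simp
    also have "\<dots> \<le> R + L * (t - t0)"
      using incr[of t0 t n] that start[of n] by (auto simp: W0 intro!: add_mono)
    also have "\<dots> \<le> R + L * T" using that L0 by (auto intro!: mult_left_mono)
    finally show ?thesis .
  qed
  have equi: "\<exists>d. 0 < d \<and> (\<forall>n y. y \<in> {t0..t0+T} \<and> norm (x - y) < d \<longrightarrow> norm (W n x - W n y) < e)"
    if x: "x \<in> {t0..t0+T}" and e: "0 < e" for x e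
  proof (intro exI conjI allI impI)
    show "0 < e / (L + 1)" using e L0 by simp
    fix n y assume y: "y \<in> {t0..t0+T} \<and> norm (x - y) < e / (L + 1)"
    have "norm (W n x - W n y) \<le> L * norm (x - y)" using lip x y by blast
    also have "\<dots> \<le> (L + 1) * norm (x - y)" by (simp add: mult_right_mono)
    also have "\<dots> < e" using y L0 by (auto simp: field_simps)
    finally show "norm (W n x - W n y) < e" .
  qed
  obtain w r where w: "continuous_on {t0..t0+T} w" and r: "strict_mono (r :: nat \<Rightarrow> nat)"
    and unif: "\<And>e. 0 < e \<Longrightarrow> \<exists>N. \<forall>n x. n \<ge> N \<and> x \<in> {t0..t0+T} \<longrightarrow> norm (W (r n) x - w x) < e"
    using Arzela_Ascoli[of "{t0..t0+T}" W "R + L * T"] bound equi by (metis compact_Icc)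
  have conv: "(\<lambda>n. W (r n) t) \<longlonglongrightarrow> w t" if "t \<in> {t0..t0+T}" for t
  proof (rule LIMSEQ_I)
    fix e :: real assume "0 < e"
    with unif[of e] that show "\<exists>no. \<forall>n\<ge>no. norm (W (r n) t - w t) < e" by blast
  qed
  have h_lim: "(\<lambda>n. h (r n)) \<longlonglongrightarrow> 0"
  proof -
    have "h \<longlonglongrightarrow> 0" unfolding h_def by (rule LIMSEQ_Suc[OF lim_const_over_n])
    then show ?thesis using LIMSEQ_subseq_LIMSEQ[OF _ r] by (auto simp: o_def)
  qed
  have deriv: "(w has_vector_derivative F t (w t)) (at t)"
    if t: "t \<in> {t0<..<t0+T}" and cont: "isCont (\<lambda>(s, y). F s y) (t, w t)" for t
    unfolding has_vector_derivative_def has_derivative_at_alt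
  proof (intro conjI allI impI)
    show "bounded_linear (\<lambda>x. x *\<^sub>R F t (w t))" by (rule bounded_linear_scaleR_left)
    fix e :: real assume e: "0 < e"
    obtain d where d: "0 < d"
      and Fd: "\<And>s y. dist (s, y) (t, w t) < d \<Longrightarrow> dist (F s y) (F t (w t)) < e"
      using cont e unfolding continuous_at_eps_delta by (metis case_prod_conv)
    have "isCont w t" using continuous_on_interior[OF w] t by (simp add: interior_atLeastAtMost_real)
    then obtain d1 where d1: "0 < d1" and wd: "\<And>s. dist s t < d1 \<Longrightarrow> dist (w s) (w t) < d/4"
      using d unfolding continuous_at_eps_delta by (metis zero_less_divide_iff zero_less_numeral)
    \<comment> \<open>A step whose interval meets \<open>(u, v)\<close> may start as much as one step length before \<open>u\<close>; hence the
      radius \<open>2 * \<eta>\<close> for the nodes, the step length being less than \<open>\<eta>\<close>.\<close>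
    define \<eta> where "\<eta> = min (min d1 (d/2)) (min (t - t0) (t0 + T - t)) / 2"
    have \<eta>: "0 < \<eta>" "2 * \<eta> \<le> d1" "2 * \<eta> \<le> d/2" "2 * \<eta> \<le> t - t0" "2 * \<eta> \<le> t0 + T - t"
      using d d1 t by (auto simp: \<eta>_def min_def)
    have key: "norm (w v - w u - (v - u) *\<^sub>R F t (w t)) \<le> e * (v - u)"
      if uv: "u \<le> v" "t - \<eta> < u" "v < t + \<eta>" for u v
    proof -
      have uvI: "u \<in> {t0..t0+T}" "v \<in> {t0..t0+T}" using uv \<eta> t by auto
      obtain N where N: "\<And>n x. n \<ge> N \<Longrightarrow> x \<in> {t0..t0+T} \<Longrightarrow> norm (W (r n) x - w x) < d/4"
        using unif[of "d/4"] d by auto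
      have "\<forall>\<^sub>F n in sequentially. norm (W (r n) v - W (r n) u - (v - u) *\<^sub>R F t (w t)) \<le> e * (v - u)"
        using eventually_ge_at_top[of N] order_tendstoD(2)[OF h_lim \<eta>(1)]
      proof eventually_elim
        case (elim n)
        show ?case unfolding W_def
        proof (rule euler_polygon_increment)
          show "0 \<le> h (r n)" "t0 \<le> u" "u \<le> v" "v \<le> t0 + real (Suc (r n)) * h (r n)"
            using h0[of "r n"] uvI uv unfolding hT by auto
          fix k assume k: "k < Suc (r n)" "u - h (r n) < t0 + real k * h (r n)"
            "t0 + real k * h (r n) < v"
          define s where "s = t0 + real k * h (r n)"
          have s: "\<bar>s - t\<bar> < 2 * \<eta>" using k uv elim \<eta> by (auto simp: s_def)
          then have sI: "s \<in> {t0..t0+T}" using \<eta> by auto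
          have node: "W (r n) s = euler_node F t0 (h (r n)) (z (r n)) k"
            unfolding W_def s_def using euler_polygon_at_node[of "h (r n)" k "Suc (r n)"] k h0[of "r n"]
            by simp
          have "dist (s, W (r n) s) (t, w t) \<le> dist s t + dist (W (r n) s) (w t)"
            unfolding dist_Pair_Pair by (rule sqrt_sum_squares_le_sum) auto
          also have "dist (W (r n) s) (w t) \<le> dist (W (r n) s) (w s) + dist (w s) (w t)"
            by (rule dist_triangle)
          also have "dist s t + (dist (W (r n) s) (w s) + dist (w s) (w t)) < d/2 + (d/4 + d/4)"
            using s \<eta> N[OF elim(1) sI] wd[of s] by (intro add_strict_mono) (auto simp: dist_norm)
          finally have "dist (F s (W (r n) s)) (F t (w t)) < e" by (intro Fd) simp
          then show "norm (F (t0 + real k * h (r n)) (euler_node F t0 (h (r n)) (z (r n)) k) - F t (w t)) \<le> e"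
            unfolding node[symmetric] s_def[symmetric] by (simp add: dist_norm)
        qed
      qed
      moreover have "(\<lambda>n. W (r n) v - W (r n) u - (v - u) *\<^sub>R F t (w t))
          \<longlonglongrightarrow> w v - w u - (v - u) *\<^sub>R F t (w t)"
        by (intro tendsto_intros conv uvI)
      ultimately show ?thesis by (intro Lim_norm_ubound[OF trivial_limit_sequentially])
    qed
    show "\<exists>d>0. \<forall>y. norm (y - t) < d \<longrightarrow>
        norm (w y - w t - (y - t) *\<^sub>R F t (w t)) \<le> e * norm (y - t)"
    proof (intro exI conjI allI impI)
      show "0 < \<eta>" by fact
      fix y assume y: "norm (y - t) < \<eta>"
      show "norm (w y - w t - (y - t) *\<^sub>R F t (w t)) \<le> e * norm (y - t)"
      proof (cases "t \<le> y")
        case True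
        then show ?thesis using key[of t y] y \<eta> by simp
      next
        case False
        have "norm (w y - w t - (y - t) *\<^sub>R F t (w t)) = norm (w t - w y - (t - y) *\<^sub>R F t (w t))"
          by (subst norm_minus_cancel[symmetric]) (simp add: algebra_simps)
        with False show ?thesis using key[of y t] y \<eta> by simp
      qed
    qed
  qed
  have wbound: "norm (w t) \<le> R + L * T" if "t \<in> {t0..t0+T}" for t
    using Lim_norm_ubound[OF trivial_limit_sequentially conv[OF that]] bound[OF that] by simp
  show thesis
    using that[of r w] r w conv deriv wbound unfolding W_def by blast
qed


section \<open>The multiplier problem for a second-order equation\<close>

text \<open>
  Let \<open>(x, y)\<close> be the initial point and \<open>(x', y')\<close> the last node. The increments \<open>S = y' - y\<close> and
  \<open>R = x' - x - T y\<close> are bounded independently of \<open>(x, y)\<close>, and the condition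
  \<open>(x, y) = c (x', y')\<close> says that \<open>y = - \<kappa> S\<close> and \<open>x = - \<kappa> (T y + R)\<close>. So the map that sends
  \<open>(x, y)\<close> to these right-hand sides preserves a rectangle, and Brouwer's theorem applies.
\<close>

lemma euler_closed_orbit:
  fixes H :: "real \<Rightarrow> real \<times> real \<Rightarrow> real"
  assumes c: "1 < c" and T: "0 < T" and N: "0 < N"
    and H_bound: "\<And>t z. \<bar>H t z\<bar> \<le> B" and H_cont: "\<And>t. continuous_on UNIV (H t)"
  defines "F \<equiv> \<lambda>t z. (snd z, H t z)" and "h \<equiv> T / real N" and "\<kappa> \<equiv> c / (c - 1)"
  obtains z where "z = c *\<^sub>R euler_node F t0 h z N"
    "\<bar>fst z\<bar> \<le> \<kappa> * (\<kappa> + 1) * T\<^sup>2 * B" "\<bar>snd z\<bar> \<le> \<kappa> * T * B"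
    "\<And>k. k \<le> N \<Longrightarrow> \<bar>snd (euler_node F t0 h z k)\<bar> \<le> (\<kappa> + 1) * T * B"
proof -
  define E where "E = (\<lambda>z k. euler_node F t0 h z k)"
  have E_Suc: "fst (E z (Suc k)) = fst (E z k) + h * snd (E z k)"
    "snd (E z (Suc k)) = snd (E z k) + h * H (t0 + real k * h) (E z k)"
    and E_0: "E z 0 = z" for z k
    by (simp_all add: E_def F_def)
  have h: "0 < h" "real N * h = T" using N T by (simp_all add: h_def)
  have kh: "real k * h \<le> T" if "k \<le> N" for k
    using that h by (metis mult_right_mono less_imp_le of_nat_mono)
  have B: "0 \<le> B" using H_bound[of 0 0] by linarith
  have \<kappa>: "0 < \<kappa>" using c by (simp add: \<kappa>_def)
  have snd_incr: "\<bar>snd (E z k) - snd z\<bar> \<le> real k * h * B" for z k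
  proof (induction k)
    case (Suc k)
    have "\<bar>h * H (t0 + real k * h) (E z k)\<bar> \<le> h * B"
      using h H_bound by (simp add: abs_mult)
    with Suc show ?case unfolding E_Suc by (simp add: algebra_simps)
  qed (simp add: E_0)
  have snd_incr': "\<bar>snd (E z k) - snd z\<bar> \<le> T * B" if "k \<le> N" for z k
    using snd_incr[of z k] mult_right_mono[OF kh[OF that] B] by linarith
  have fst_incr: "\<bar>fst (E z k) - fst z - real k * h * snd z\<bar> \<le> real k * h * (T * B)" if "k \<le> N" for z k
    using that
  proof (induction k)
    case (Suc k)
    have "\<bar>h * (snd (E z k) - snd z)\<bar> \<le> h * (T * B)"
      unfolding abs_mult using h snd_incr'[of k z] Suc.prems by (intro mult_mono) auto
    with Suc show ?case unfolding E_Suc by (simp add: algebra_simps)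
  qed (simp add: E_0)
  have E_cont: "continuous_on UNIV (\<lambda>z. E z k)" for k
  proof (induction k)
    case (Suc k)
    have "continuous_on UNIV (\<lambda>z. H (t0 + real k * h) (E z k))"
      by (rule continuous_on_compose2[OF H_cont Suc]) simp
    with Suc show ?case unfolding E_def F_def by (auto intro!: continuous_intros)
  qed (simp add: E_def)
  define ynew where "ynew = (\<lambda>z. - \<kappa> * (snd (E z N) - snd z))"
  define \<Phi> where
    "\<Phi> = (\<lambda>z. (- \<kappa> * (T * ynew z + (fst (E z N) - fst z - T * snd z)), ynew z))"
  define Y where "Y = \<kappa> * (T * B)"
  define X where "X = \<kappa> * (T * Y + T * (T * B))"
  have ynew: "\<bar>ynew z\<bar> \<le> Y" for z
    unfolding ynew_def Y_def abs_mult using \<kappa> snd_incr'[of N z] by (intro mult_mono) auto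
  have xnew: "\<bar>fst (\<Phi> z)\<bar> \<le> X" for z
  proof -
    have "\<bar>T * ynew z\<bar> \<le> T * Y" using ynew[of z] T by (simp add: abs_mult)
    moreover have "\<bar>fst (E z N) - fst z - T * snd z\<bar> \<le> T * (T * B)"
      using fst_incr[of N z] h(2) by simp
    ultimately have "\<bar>T * ynew z + (fst (E z N) - fst z - T * snd z)\<bar> \<le> T * Y + T * (T * B)"
      by linarith
    then show ?thesis unfolding \<Phi>_def X_def using \<kappa> by (simp add: abs_mult)
  qed
  have XY: "0 \<le> X" "0 \<le> Y" using B T \<kappa> by (auto simp: X_def Y_def)
  obtain z where z: "z \<in> {-X..X} \<times> {-Y..Y}" "\<Phi> z = z"
  proof (rule brouwer[of "{-X..X} \<times> {-Y..Y}" \<Phi>])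
    show "compact ({-X..X} \<times> {-Y..Y})" by (intro compact_Times compact_Icc)
    show "convex ({-X..X} \<times> {-Y..Y})" by (intro convex_Times convex_real_interval)
    show "{-X..X} \<times> {-Y..Y} \<noteq> {}" using XY by auto
    have "continuous_on UNIV \<Phi>" unfolding \<Phi>_def ynew_def by (intro continuous_intros E_cont)
    then show "continuous_on ({-X..X} \<times> {-Y..Y}) \<Phi>" by (rule continuous_on_subset) simp
    show "\<Phi> \<in> {-X..X} \<times> {-Y..Y} \<rightarrow> {-X..X} \<times> {-Y..Y}"
      using xnew ynew by (auto simp: \<Phi>_def abs_le_iff minus_le_iff)
  qed
  have yz: "ynew z = snd z" using z(2) by (metis \<Phi>_def snd_conv)
  have xz: "- \<kappa> * (T * snd z + (fst (E z N) - fst z - T * snd z)) = fst z"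
    using arg_cong[OF z(2), of fst] yz by (simp add: \<Phi>_def)
  have "snd z = c * snd (E z N)" using yz c by (simp add: ynew_def \<kappa>_def field_simps)
  moreover have "fst z = c * fst (E z N)" using xz c by (simp add: \<kappa>_def field_simps)
  ultimately have "z = c *\<^sub>R euler_node F t0 h z N" by (simp add: prod_eq_iff E_def)
  moreover have "\<bar>fst z\<bar> \<le> \<kappa> * (\<kappa> + 1) * T\<^sup>2 * B"
  proof -
    have "X = \<kappa> * (\<kappa> + 1) * T\<^sup>2 * B"
      by (simp add: X_def Y_def power2_eq_square algebra_simps)
    then show ?thesis using z(1) by (auto simp: mem_Times_iff)
  qed
  moreover have ybound: "\<bar>snd z\<bar> \<le> \<kappa> * T * B"
    using z(1) by (auto simp: mem_Times_iff Y_def)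
  moreover have "\<bar>snd (euler_node F t0 h z k)\<bar> \<le> (\<kappa> + 1) * T * B" if "k \<le> N" for k
    using snd_incr'[OF that, of z] ybound by (simp add: E_def algebra_simps)
  ultimately show thesis using that by blast
qed

text \<open>
  The bound is linear in \<open>B\<close> with a factor that does not depend on the right-hand side; this is what
  allows an a priori estimate for sublinear nonlinearities by truncation.
\<close>

lemma bounded_multiplier_problem:
  fixes c T t0 :: real
  assumes c: "1 < c" and T: "0 < T"
  obtains K where "0 < K"
    "\<And>H B. (\<And>t z. \<bar>H t z\<bar> \<le> B) \<Longrightarrow> (\<And>t. continuous_on UNIV (H t)) \<Longrightarrow>
       \<exists>w :: real \<Rightarrow> real \<times> real. continuous_on {t0..t0+T} w \<and> w t0 = c *\<^sub>R w (t0 + T) \<and>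
         (\<forall>t\<in>{t0..t0+T}. norm (w t) \<le> K * B) \<and>
         (\<forall>t\<in>{t0<..<t0+T}. isCont (\<lambda>(s, z). H s z) (t, w t) \<longrightarrow>
            (w has_vector_derivative (snd (w t), H t (w t))) (at t))"
proof -
  define \<kappa> where "\<kappa> = c / (c - 1)"
  have \<kappa>: "0 < \<kappa>" using c by (simp add: \<kappa>_def)
  define R where "R = \<kappa> * (\<kappa> + 1) * T\<^sup>2 + \<kappa> * T"
  define L where "L = (\<kappa> + 1) * T + 1"
  show thesis
  proof (rule that)
    show "0 < R + L * T" using \<kappa> T by (auto simp: R_def L_def intro!: add_pos_pos mult_pos_pos)
    fix H :: "real \<Rightarrow> real \<times> real \<Rightarrow> real" and B
    assume HB: "\<And>t z. \<bar>H t z\<bar> \<le> B" and HC: "\<And>t. continuous_on UNIV (H t)"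
    define F where "F = (\<lambda>t z. (snd z, H t z))"
    define h where "h = (\<lambda>n. T / real (Suc n))"
    have "\<forall>n. \<exists>z. z = c *\<^sub>R euler_node F t0 (h n) z (Suc n) \<and>
      \<bar>fst z\<bar> \<le> \<kappa> * (\<kappa> + 1) * T\<^sup>2 * B \<and> \<bar>snd z\<bar> \<le> \<kappa> * T * B \<and>
      (\<forall>k\<le>Suc n. \<bar>snd (euler_node F t0 (h n) z k)\<bar> \<le> (\<kappa> + 1) * T * B)"
    proof
      fix n
      show "\<exists>z. z = c *\<^sub>R euler_node F t0 (h n) z (Suc n) \<and>
        \<bar>fst z\<bar> \<le> \<kappa> * (\<kappa> + 1) * T\<^sup>2 * B \<and> \<bar>snd z\<bar> \<le> \<kappa> * T * B \<and>
        (\<forall>k\<le>Suc n. \<bar>snd (euler_node F t0 (h n) z k)\<bar> \<le> (\<kappa> + 1) * T * B)"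
        unfolding F_def h_def \<kappa>_def
        by (rule euler_closed_orbit[of c T "Suc n" H B t0, OF c T zero_less_Suc HB HC]) blast
    qed
    then obtain z where z: "\<And>n. z n = c *\<^sub>R euler_node F t0 (h n) (z n) (Suc n)"
      "\<And>n. \<bar>fst (z n)\<bar> \<le> \<kappa> * (\<kappa> + 1) * T\<^sup>2 * B" "\<And>n. \<bar>snd (z n)\<bar> \<le> \<kappa> * T * B"
      "\<And>n k. k \<le> Suc n \<Longrightarrow> \<bar>snd (euler_node F t0 (h n) (z n) k)\<bar> \<le> (\<kappa> + 1) * T * B"
      by metis
    have start: "norm (z n) \<le> R * B" for n
      using norm_Pair_le[of "fst (z n)" "snd (z n)"] z(2)[of n] z(3)[of n]
      by (simp add: R_def algebra_simps)
    have slope: "norm (F (t0 + real k * h n) (euler_node F t0 (h n) (z n) k)) \<le> L * B"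
      if "k \<le> n" for n k
      using norm_Pair_le[of "snd (euler_node F t0 (h n) (z n) k)"
          "H (t0 + real k * h n) (euler_node F t0 (h n) (z n) k)"]
        HB[of "t0 + real k * h n" "euler_node F t0 (h n) (z n) k"] z(4)[of k n] that
      by (simp add: F_def L_def algebra_simps)
    obtain w r where w: "strict_mono (r :: nat \<Rightarrow> nat)" "continuous_on {t0..t0+T} w"
      and conv: "\<And>t. t \<in> {t0..t0+T} \<Longrightarrow>
         (\<lambda>n. euler_polygon F t0 (h (r n)) (Suc (r n)) (z (r n)) t) \<longlonglongrightarrow> w t"
      and deriv: "\<And>t. t \<in> {t0<..<t0+T} \<Longrightarrow> isCont (\<lambda>(s, y). F s y) (t, w t) \<Longrightarrow>
         (w has_vector_derivative F t (w t)) (at t)"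
      and wb: "\<And>t. t \<in> {t0..t0+T} \<Longrightarrow> norm (w t) \<le> R * B + (L * B) * T"
      by (rule euler_polygons_converge[of T h z "R * B" F t0 "L * B", OF T _ start slope])
        (auto simp: h_def)
    have h0: "0 \<le> h n" "t0 + T = t0 + real (Suc n) * h n" for n
      using T by (simp_all add: h_def)
    have "(\<lambda>n. euler_polygon F t0 (h (r n)) (Suc (r n)) (z (r n)) t0)
      = (\<lambda>n. c *\<^sub>R euler_polygon F t0 (h (r n)) (Suc (r n)) (z (r n)) (t0 + T))"
    proof
      fix n
      have "euler_polygon F t0 (h (r n)) (Suc (r n)) (z (r n)) t0 = z (r n)"
        using euler_polygon_at_node[of "h (r n)" 0 "Suc (r n)" F t0 "z (r n)"] h0 by simp
      also have "\<dots> = c *\<^sub>R euler_node F t0 (h (r n)) (z (r n)) (Suc (r n))" by (rule z(1))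
      also have "\<dots> = c *\<^sub>R euler_polygon F t0 (h (r n)) (Suc (r n)) (z (r n)) (t0 + T)"
        unfolding h0(2)[of "r n"] using euler_polygon_at_node[OF h0(1) order_refl] by metis
      finally show "euler_polygon F t0 (h (r n)) (Suc (r n)) (z (r n)) t0 = \<dots>" .
    qed
    then have bc: "w t0 = c *\<^sub>R w (t0 + T)"
      using conv[of t0] tendsto_scaleR[OF tendsto_const conv[of "t0 + T"], of c] T
      by (auto intro: LIMSEQ_unique)
    have FC: "isCont (\<lambda>(s, y). F s y) q" if "isCont (\<lambda>(s, y). H s y) q" for q
      using that unfolding F_def case_prod_unfold by (intro continuous_intros)
    show "\<exists>w :: real \<Rightarrow> real \<times> real. continuous_on {t0..t0+T} w \<and> w t0 = c *\<^sub>R w (t0 + T) \<and>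
         (\<forall>t\<in>{t0..t0+T}. norm (w t) \<le> (R + L * T) * B) \<and>
         (\<forall>t\<in>{t0<..<t0+T}. isCont (\<lambda>(s, z). H s z) (t, w t) \<longrightarrow>
            (w has_vector_derivative (snd (w t), H t (w t))) (at t))"
    proof (intro exI[of _ w] conjI ballI impI)
      fix t assume t: "t \<in> {t0..t0+T}"
      show "norm (w t) \<le> (R + L * T) * B" using wb[OF t] by (simp add: algebra_simps)
    next
      fix t assume t: "t \<in> {t0<..<t0+T}" and C: "isCont (\<lambda>(s, z). H s z) (t, w t)"
      show "(w has_vector_derivative (snd (w t), H t (w t))) (at t)"
        using deriv[OF t FC[OF C]] by (simp add: F_def)
    qed (fact w(2) bc)+
  qed
qed

lemma sublinear_bound:
  fixes g :: "real \<Rightarrow> real"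
  assumes g: "continuous_on UNIV g" and lim: "((\<lambda>x. g x / x) \<longlongrightarrow> 0) at_infinity" and e: "0 < e"
  obtains C where "0 \<le> C" "\<And>r x. \<bar>x\<bar> \<le> r \<Longrightarrow> \<bar>g x\<bar> \<le> e * r + C"
proof -
  have "\<forall>\<^sub>F x in at_infinity. \<bar>g x / x\<bar> < e"
    using tendstoD[OF lim e] by (simp add: dist_norm)
  then obtain b where b: "\<And>x. b \<le> \<bar>x\<bar> \<Longrightarrow> \<bar>g x / x\<bar> < e"
    unfolding eventually_at_infinity by auto
  have "compact (g ` {-\<bar>b\<bar>-1..\<bar>b\<bar>+1})"
    by (intro compact_continuous_image continuous_on_subset[OF g]) auto
  then obtain C where C: "\<And>x. x \<in> {-\<bar>b\<bar>-1..\<bar>b\<bar>+1} \<Longrightarrow> \<bar>g x\<bar> \<le> C"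
    by (metis bounded_iff compact_imp_bounded image_eqI real_norm_def)
  have C0: "0 \<le> C" by (rule order_trans[OF abs_ge_zero C[of 0]]) simp
  have "\<bar>g x\<bar> \<le> e * r + C" if "\<bar>x\<bar> \<le> r" for r x
  proof (cases "\<bar>x\<bar> \<le> \<bar>b\<bar> + 1")
    case True
    then have "\<bar>g x\<bar> \<le> C" by (intro C) auto
    moreover have "0 \<le> e * r" using that e by auto
    ultimately show ?thesis by linarith
  next
    case False
    then have "x \<noteq> 0" "\<bar>g x\<bar> / \<bar>x\<bar> < e" using b[of x] by (auto simp: abs_divide)
    then have "\<bar>g x\<bar> \<le> e * \<bar>x\<bar>" by (simp add: pos_divide_less_eq less_imp_le)
    also have "\<dots> \<le> e * r" using that e by simp
    finally show ?thesis using C0 by simp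
  qed
  then show thesis using that[of C] C0 by simp
qed

text \<open>
  The nonlinearity is frozen outside \<open>[-r, r]\<close>. With \<open>P\<close> a bound of \<open>p\<close>, the value of \<open>r\<close> is chosen
  such that \<open>c K (P + e r + C) = r\<close>, so that \<open>M\<close> times the solution of the modified problem never
  leaves \<open>[-r, r]\<close>.
\<close>

lemma sublinear_multiplier_problem:
  fixes c T t0 :: real and M g :: "real \<Rightarrow> real" and p :: "real \<times> real \<times> real \<Rightarrow> real"
  assumes c: "1 < c" and T: "0 < T" and M: "\<And>t. 1 \<le> M t" "\<And>t. M t \<le> c"
    and p: "bounded (range p)" "continuous_on UNIV p"
    and g: "continuous_on UNIV g" "((\<lambda>x. g x / x) \<longlongrightarrow> 0) at_infinity"
  obtains w :: "real \<Rightarrow> real \<times> real" where "continuous_on {t0..t0+T} w"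
    "w t0 = c *\<^sub>R w (t0 + T)"
    "\<And>t. t \<in> {t0<..<t0+T} \<Longrightarrow> isCont M t \<Longrightarrow>
       (w has_vector_derivative
         (snd (w t), (p (t, M t *\<^sub>R w t) - g (M t * fst (w t))) / M t)) (at t)"
proof -
  obtain K where K: "0 < K" and
    ex: "\<And>H B. (\<And>t z. \<bar>H t z\<bar> \<le> B) \<Longrightarrow> (\<And>t. continuous_on UNIV (H t)) \<Longrightarrow>
       \<exists>w :: real \<Rightarrow> real \<times> real. continuous_on {t0..t0+T} w \<and> w t0 = c *\<^sub>R w (t0 + T) \<and>
         (\<forall>t\<in>{t0..t0+T}. norm (w t) \<le> K * B) \<and>
         (\<forall>t\<in>{t0<..<t0+T}. isCont (\<lambda>(s, z). H s z) (t, w t) \<longrightarrow>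
            (w has_vector_derivative (snd (w t), H t (w t))) (at t))"
    using bounded_multiplier_problem[OF c T] by metis
  obtain P where P: "\<And>q. \<bar>p q\<bar> \<le> P" "0 \<le> P"
    using p(1) unfolding bounded_iff by (metis abs_ge_zero order_trans rangeI real_norm_def)
  \<comment> \<open>This \<open>e\<close> lets the sublinear part use up exactly half of \<open>r\<close>.\<close>
  define e where "e = 1 / (2 * c * K)"
  have "0 < e" using c K by (simp add: e_def)
  then obtain C where C: "0 \<le> C" "\<And>r x. \<bar>x\<bar> \<le> r \<Longrightarrow> \<bar>g x\<bar> \<le> e * r + C"
    using sublinear_bound[OF g] by metis
  define r where "r = 2 * c * K * (P + C)"
  define B where "B = P + (e * r + C)"
  have r: "0 \<le> r" using c K P C by (simp add: r_def)
  have cKB: "c * (K * B) = r" using c K by (simp add: B_def r_def e_def field_simps)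
  define H where "H = (\<lambda>t z. (p (t, M t *\<^sub>R z) - g (max (- r) (min r (M t * fst z)))) / M t)"
  have M0: "0 < M t" "M t \<noteq> 0" for t using M(1)[of t] by auto
  have HB: "\<bar>H t z\<bar> \<le> B" for t z
  proof -
    have "\<bar>p (t, M t *\<^sub>R z) - g (max (- r) (min r (M t * fst z)))\<bar> \<le> P + (e * r + C)"
      by (rule order_trans[OF abs_triangle_ineq4 add_mono[OF P(1) C(2)]]) (use r in auto)
    moreover have "\<bar>H t z\<bar> \<le> \<bar>p (t, M t *\<^sub>R z) - g (max (- r) (min r (M t * fst z)))\<bar>"
      using M(1)[of t] by (simp add: H_def abs_divide divide_le_eq mult_left_le_one_le mult_le_cancel_left1)
    ultimately show ?thesis by (simp add: B_def)
  qed
  have HC: "continuous_on UNIV (H t)" for t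
    unfolding H_def using M0
    by (intro continuous_intros continuous_on_compose2[OF p(2)] continuous_on_compose2[OF g(1)]) auto
  obtain w where w: "continuous_on {t0..t0+T} w" "w t0 = c *\<^sub>R w (t0 + T)"
    and wB: "\<And>t. t \<in> {t0..t0+T} \<Longrightarrow> norm (w t) \<le> K * B"
    and wd: "\<And>t. t \<in> {t0<..<t0+T} \<Longrightarrow> isCont (\<lambda>(s, z). H s z) (t, w t) \<Longrightarrow>
            (w has_vector_derivative (snd (w t), H t (w t))) (at t)"
    using ex[of H B] HB HC by blast
  show thesis
  proof (rule that[OF w])
    fix t assume t: "t \<in> {t0<..<t0+T}" and Mt: "isCont M t"
    have M': "isCont (\<lambda>q. M (fst q)) (t, w t)"
      using Mt by (intro continuous_at_compose[of "(t, w t)" fst M, unfolded o_def] continuous_intros) auto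
    have p': "isCont (\<lambda>q. p (fst q, M (fst q) *\<^sub>R snd q)) (t, w t)"
      by (rule isCont_o2[where g = p])
        (use M' p(2) in \<open>auto intro!: continuous_intros
            simp: continuous_on_eq_continuous_at simp del: split_paired_All\<close>)
    have g': "isCont (\<lambda>q. g (max (- r) (min r (M (fst q) * fst (snd q))))) (t, w t)"
      by (rule isCont_o2[where g = g])
        (use M' g(1) in \<open>auto intro!: continuous_intros simp: continuous_on_eq_continuous_at\<close>)
    have "isCont (\<lambda>q. H (fst q) (snd q)) (t, w t)"
      unfolding H_def using M0 by (intro isCont_divide isCont_diff p' g' M') auto
    then have "(w has_vector_derivative (snd (w t), H t (w t))) (at t)"
      using wd[OF t] by (simp add: case_prod_unfold)
    moreover have "H t (w t) = (p (t, M t *\<^sub>R w t) - g (M t * fst (w t))) / M t"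
    proof -
      have "\<bar>fst (w t)\<bar> \<le> K * B" using norm_fst_le[of "fst (w t)" "snd (w t)"] wB[of t] t by simp
      then have "\<bar>M t * fst (w t)\<bar> \<le> c * (K * B)"
        unfolding abs_mult using M0[of t] M(2)[of t] by (intro mult_mono) auto
      then have "max (- r) (min r (M t * fst (w t))) = M t * fst (w t)" unfolding cKB by linarith
      then show ?thesis by (simp only: H_def)
    qed
    ultimately show "(w has_vector_derivative
        (snd (w t), (p (t, M t *\<^sub>R w t) - g (M t * fst (w t))) / M t)) (at t)"
      by (simp only:)
  qed
qed

section \<open>Periodic extension from a half-open interval\<close>

lemma int_shift_invariant:
  fixes f :: "int \<Rightarrow> 'a"
  assumes "\<And>n. f (n + 1) = f n"
  shows "f n = f 0"
proof (induction n rule: int_induct[where k = 0])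
  case (step2 i)
  then show ?case using assms[of "i - 1"] by simp
qed (simp_all add: assms)

text \<open>
  The representative of \<open>t\<close> modulo \<open>T\<close> in \<open>(t0, t0 + T]\<close>. The interval is closed on the right
  because the solutions are continuous from the left.
\<close>

definition fold_into :: "real \<Rightarrow> real \<Rightarrow> real \<Rightarrow> real" where
  "fold_into t0 T t = t - T * (of_int \<lceil>(t - t0) / T\<rceil> - 1)"

lemma fold_into_mem:
  assumes "0 < T" shows "fold_into t0 T t \<in> {t0<..t0+T}"
proof -
  define n where "n = \<lceil>(t - t0) / T\<rceil>"
  have "(t - t0) / T \<le> of_int n" "of_int n < (t - t0) / T + 1"
    unfolding n_def using ceiling_correct[of "(t - t0) / T"] by linarith+
  then have "t - t0 \<le> of_int n * T" "of_int n * T < t - t0 + T"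
    using assms by (simp_all add: field_simps)
  then show ?thesis by (simp add: fold_into_def n_def[symmetric] algebra_simps)
qed

lemma fold_into_eqI:
  assumes "0 < T" "s - T * of_int n \<in> {t0<..t0+T}"
  shows "fold_into t0 T s = s - T * of_int n"
proof -
  have "\<lceil>(s - t0) / T\<rceil> = n + 1"
    using assms by (intro ceiling_unique) (auto simp: field_simps)
  then show ?thesis by (simp add: fold_into_def)
qed

lemma fold_into_shift:
  obtains n where "fold_into t0 T t = t - T * of_int n"
  by (rule that[of "\<lceil>(t - t0) / T\<rceil> - 1"]) (simp add: fold_into_def)

lemma fold_into_periodic:
  assumes "0 < T" shows "fold_into t0 T (t + T) = fold_into t0 T t"
proof -
  obtain n where n: "fold_into t0 T t = t - T * of_int n" by (rule fold_into_shift)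
  then have "t + T - T * of_int (n + 1) = fold_into t0 T t" by (simp add: algebra_simps)
  then show ?thesis using fold_into_eqI[OF assms, of "t + T" "n + 1" t0] fold_into_mem[OF assms] by metis
qed

lemma filterlim_fold_into_left:
  assumes T: "0 < T"
  shows "filterlim (fold_into t0 T) (at_left (fold_into t0 T t)) (at_left t)"
proof -
  obtain n where n: "fold_into t0 T t = t - T * of_int n" by (rule fold_into_shift)
  have "filterlim (\<lambda>s. s - T * of_int n) (at_left (t - T * of_int n)) (at_left t)"
    by (subst filtermap_at_left_shift[symmetric]) (simp add: filterlim_def)
  moreover have "\<forall>\<^sub>F s in at_left t. s - T * of_int n = fold_into t0 T s"
  proof -
    have "t0 + T * of_int n < t" using fold_into_mem[OF T, of t0 t] n by auto
    then show ?thesis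
      using fold_into_mem[OF T, of t0 t] n
      by (intro eventually_at_leftI[of "t0 + T * of_int n"] fold_into_eqI[symmetric] T) auto
  qed
  ultimately show ?thesis unfolding n by (rule filterlim_cong[THEN iffD1, OF refl refl, rotated])
qed

lemma filterlim_fold_into_right:
  assumes T: "0 < T" and t: "fold_into t0 T t < t0 + T"
  shows "filterlim (fold_into t0 T) (at_right (fold_into t0 T t)) (at_right t)"
proof -
  obtain n where n: "fold_into t0 T t = t - T * of_int n" by (rule fold_into_shift)
  have "filterlim (\<lambda>s. s - T * of_int n) (at_right (t - T * of_int n)) (at_right t)"
    by (subst filtermap_at_right_shift[symmetric]) (simp add: filterlim_def)
  moreover have "\<forall>\<^sub>F s in at_right t. s - T * of_int n = fold_into t0 T s"
    using fold_into_mem[OF T, of t0 t] n t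
    by (intro eventually_at_rightI[of _ "t0 + T + T * of_int n"] fold_into_eqI[symmetric] T) auto
  ultimately show ?thesis unfolding n by (rule filterlim_cong[THEN iffD1, OF refl refl, rotated])
qed

text \<open>
  At a seam the representative jumps from the right end of the interval to its left end, so
  limits from the right are taken at \<open>t0\<close>.
\<close>

lemma filterlim_fold_into_right_seam:
  assumes T: "0 < T" and t: "fold_into t0 T t = t0 + T"
  shows "filterlim (fold_into t0 T) (at_right t0) (at_right t)"
proof -
  obtain n where n: "fold_into t0 T t = t - T * of_int n" by (rule fold_into_shift)
  have t0: "t - T * of_int (n + 1) = t0" using n t by (simp add: algebra_simps)
  have "filterlim (\<lambda>s. s - T * of_int (n + 1)) (at_right (t - T * of_int (n + 1))) (at_right t)"
    by (subst filtermap_at_right_shift[symmetric]) (simp add: filterlim_def)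
  moreover have "\<forall>\<^sub>F s in at_right t. s - T * of_int (n + 1) = fold_into t0 T s"
    using T t0
    by (intro eventually_at_rightI[of _ "t + T"] fold_into_eqI[symmetric] T) auto
  ultimately show ?thesis unfolding t0 by (rule filterlim_cong[THEN iffD1, OF refl refl, rotated])
qed

lemma has_real_derivative_fold_into:
  assumes T: "0 < T" and t: "fold_into t0 T t < t0 + T"
    and f: "(f has_real_derivative D) (at (fold_into t0 T t))"
  shows "((\<lambda>s. f (fold_into t0 T s)) has_real_derivative D) (at t)"
proof -
  obtain n where n: "fold_into t0 T t = t - T * of_int n" by (rule fold_into_shift)
  have "((\<lambda>s. f (s - T * of_int n)) has_real_derivative D * (1 - 0)) (at t)"
    using f unfolding n by (intro DERIV_chain2[where f = f] derivative_intros) auto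
  moreover have "\<forall>\<^sub>F s in nhds t. fold_into t0 T s = s - T * of_int n"
  proof -
    have "t \<in> {t0 + T * of_int n<..<t0 + T + T * of_int n}"
      using fold_into_mem[OF T, of t0 t] n t by auto
    from eventually_nhds_in_open[OF open_greaterThanLessThan this] show ?thesis
      by eventually_elim (rule fold_into_eqI[OF T], auto)
  qed
  then have "\<forall>\<^sub>F s in nhds t. f (fold_into t0 T s) = f (s - T * of_int n)"
    by eventually_elim simp
  ultimately show ?thesis by (subst DERIV_cong_ev[OF refl _ refl]) simp_all
qed

section \<open>Impulses\<close>

text \<open>
  Counting with a strict inequality makes the count continuous from the left, as the
  convention on the values at impulse times demands.
\<close>

lemma card_below_local:
  fixes \<tau> :: "int \<Rightarrow> real"
  assumes J: "finite J"
  shows "\<forall>\<^sub>F s in at_left t. card {j\<in>J. \<tau> j < s} = card {j\<in>J. \<tau> j < t}"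
    and "\<forall>\<^sub>F s in at_right t. card {j\<in>J. \<tau> j < s} = card {j\<in>J. \<tau> j \<le> t}"
proof -
  have "\<forall>\<^sub>F s in at_left t. \<forall>j\<in>J. (\<tau> j < s) = (\<tau> j < t)"
  proof (intro eventually_ball_finite J ballI)
    fix j
    show "\<forall>\<^sub>F s in at_left t. (\<tau> j < s) = (\<tau> j < t)"
    proof (cases "\<tau> j < t")
      case True
      then show ?thesis by (intro eventually_at_leftI[of "\<tau> j"]) auto
    next
      case False
      then show ?thesis by (intro eventually_at_leftI[of "t - 1"]) auto
    qed
  qed
  then show "\<forall>\<^sub>F s in at_left t. card {j\<in>J. \<tau> j < s} = card {j\<in>J. \<tau> j < t}"
    by eventually_elim (auto intro: arg_cong[where f = card])
  have "\<forall>\<^sub>F s in at_right t. \<forall>j\<in>J. (\<tau> j < s) = (\<tau> j \<le> t)"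
  proof (intro eventually_ball_finite J ballI)
    fix j
    show "\<forall>\<^sub>F s in at_right t. (\<tau> j < s) = (\<tau> j \<le> t)"
    proof (cases "\<tau> j \<le> t")
      case True
      then show ?thesis by (intro eventually_at_rightI[of _ "t + 1"]) auto
    next
      case False
      then show ?thesis by (intro eventually_at_rightI[of _ "\<tau> j"]) auto
    qed
  qed
  then show "\<forall>\<^sub>F s in at_right t. card {j\<in>J. \<tau> j < s} = card {j\<in>J. \<tau> j \<le> t}"
    by eventually_elim (auto intro: arg_cong[where f = card])
qed

text \<open>
  The multiplier problem is solved for \<open>u = x / M\<close> on a period that begins at the impulse time
  \<open>\<tau> 1\<close>. The periodic extension of \<open>M u\<close> then has its seams at impulse times, where a solution
  has to satisfy jump conditions only, and there \<open>u(t0) = c u(t0 + T)\<close> is just the jump condition: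
  the value at the seam is \<open>c u(t0 + T) = u(t0)\<close>, the limit after it is \<open>b u(t0)\<close>.
\<close>

lemma exists_periodic_impulsive_solution:
  fixes k0 :: nat and \<tau> :: "int \<Rightarrow> real" and a T :: real
    and p :: "real \<times> real \<times> real \<Rightarrow> real" and g :: "real \<Rightarrow> real"
  assumes k0: "k0 \<ge> 1" and T: "0 < T"
    and \<tau>_mono: "strict_mono_on {1..int k0} \<tau>" and \<tau>_len: "\<tau> (int k0) < \<tau> 1 + T"
    and \<tau>_per: "\<And>j. \<tau> (j + int k0) = \<tau> j + T"
    and a: "a > 0"
    and p: "bounded (range p)" "continuous_on UNIV p"
    and p_per: "\<And>t x y. p (t + T, x, y) = p (t, x, y)"
    and g: "continuous_on UNIV g" "((\<lambda>x. g x / x) \<longlongrightarrow> 0) at_infinity"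
  obtains x where "impulsive_solution \<tau> a g p x" "\<And>t. x (t + T) = x t"
proof -
  define b where "b = 1 + a"
  define c where "c = b ^ k0"
  define t0 where "t0 = \<tau> 1"
  define J where "J = {1..int k0}"
  define M where "M = (\<lambda>t. b ^ card {j\<in>J. \<tau> j < t})"
  define \<phi> where "\<phi> = fold_into t0 T"
  have J: "finite J" "card J = k0" by (simp_all add: J_def)
  have b: "1 < b" using a by (simp add: b_def)
  have c: "1 < c" using b k0 by (simp add: c_def)
  have M1: "1 \<le> M t" for t using b by (simp add: M_def)
  have Mc: "M t \<le> c" for t
    unfolding M_def c_def J(2)[symmetric] using b J(1) by (intro power_increasing card_mono) auto
  have \<tau>_inj: "inj_on \<tau> J" using strict_mono_on_imp_inj_on[OF \<tau>_mono] by (simp add: J_def)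
  have \<tau>_J: "\<tau> j \<in> {t0..<t0+T}" if "j \<in> J" for j
  proof -
    have mono: "\<tau> i \<le> \<tau> j" if "i \<in> J" "j \<in> J" "i \<le> j" for i j
      using strict_mono_onD[OF \<tau>_mono, of i j] that by (cases "i = j") (auto simp: J_def)
    have "\<tau> 1 \<le> \<tau> j" "\<tau> j \<le> \<tau> (int k0)"
      using that k0 by (auto intro!: mono simp: J_def)
    then show ?thesis using \<tau>_len by (simp add: t0_def)
  qed
  have \<tau>_shift: "\<tau> (j + n * int k0) = \<tau> j + T * of_int n" for j n
  proof -
    have "\<tau> (j + (m + 1) * int k0) - T * of_int (m + 1) = \<tau> (j + m * int k0) - T * of_int m" for m
      using \<tau>_per[of "j + m * int k0"] by (simp add: algebra_simps)
    then show ?thesis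
      using int_shift_invariant[of "\<lambda>m. \<tau> (j + m * int k0) - T * of_int m" n] by simp
  qed
  have p_shift: "p (t - T * of_int n, q) = p (t, q)" for t n q
  proof -
    obtain x y where q: "q = (x, y)" by (cases q)
    have "p (t - T * of_int (m + 1), q) = p (t - T * of_int m, q)" for m
      using p_per[of "t - T * of_int (m + 1)" x y] by (simp add: q algebra_simps)
    then show ?thesis using int_shift_invariant[of "\<lambda>m. p (t - T * of_int m, q)" n] by simp
  qed
  have \<phi>_mem: "\<phi> t \<in> {t0<..t0+T}" for t unfolding \<phi>_def by (rule fold_into_mem[OF T])
  \<comment> \<open>In \<open>(t0, t0 + T]\<close> the impulse times are \<open>\<tau> 2, \<dots>, \<tau> k0\<close> and the seam \<open>t0 + T = \<tau> (k0 + 1)\<close>.\<close>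
  have \<phi>_range: "t \<in> range \<tau> \<longleftrightarrow> \<phi> t = t0 + T \<or> \<phi> t \<in> \<tau> ` J" for t
  proof -
    obtain n where n: "\<phi> t = t - T * of_int n" unfolding \<phi>_def by (rule fold_into_shift)
    show ?thesis
    proof
      assume "\<phi> t = t0 + T \<or> \<phi> t \<in> \<tau> ` J"
      then obtain j where "\<phi> t = \<tau> j" using \<tau>_per[of 1] unfolding t0_def by (metis imageE)
      then have "t = \<tau> (j + n * int k0)" using n \<tau>_shift[of j n] by simp
      then show "t \<in> range \<tau>" by simp
    next
      assume "t \<in> range \<tau>"
      then obtain j where j: "t = \<tau> j" by auto
      \<comment> \<open>Move \<open>\<tau> j\<close> by full periods to an index \<open>i\<close> between \<open>1\<close> and \<open>k0\<close>.\<close>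
      define i where "i = (j - 1) mod int k0 + 1"
      define m where "m = (j - 1) div int k0 - n"
      have "i + (m + n) * int k0 = (j - 1) mod int k0 + (j - 1) div int k0 * int k0 + 1"
        unfolding i_def m_def by simp
      then have "i + (m + n) * int k0 = j" by simp
      then have \<phi>i: "\<phi> t = \<tau> i + T * of_int m"
        using \<tau>_shift[of i "m + n"] n j by (simp add: algebra_simps)
      have i: "i \<in> J" using k0 by (auto simp: i_def J_def add1_zle_eq)
      show "\<phi> t = t0 + T \<or> \<phi> t \<in> \<tau> ` J"
      proof (cases "m = 0")
        case True
        then show ?thesis using \<phi>i i by simp
      next
        case False
        have "t0 < \<phi> t" "\<phi> t \<le> t0 + T" "t0 \<le> \<tau> i" "\<tau> i < t0 + T"
          using \<phi>_mem[of t] \<tau>_J[OF i] by auto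
        then have "T * of_int m \<le> T * 1" "T * (- 1) < T * of_int m"
          using \<phi>i by linarith+
        then have "real_of_int m \<le> 1" "- 1 < real_of_int m"
          using T by (simp_all only: mult_le_cancel_left_pos mult_less_cancel_left_pos)
        then have "m = 1" using False by linarith
        then show ?thesis using \<phi>i \<phi>_mem[of t] \<tau>_J[OF i] by auto
      qed
    qed
  qed
  have M_left: "\<forall>\<^sub>F s in at_left t. M s = M t" for t
    using card_below_local(1)[OF J(1), of \<tau> t] by eventually_elim (simp add: M_def)
  have M_right: "\<forall>\<^sub>F s in at_right t. M s = b ^ card {j\<in>J. \<tau> j \<le> t}" for t
    using card_below_local(2)[OF J(1), of \<tau> t] by eventually_elim (simp add: M_def)
  have M_jump: "b ^ card {j\<in>J. \<tau> j \<le> t} = b * M t" if t: "t \<in> \<tau> ` J" for t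
  proof -
    obtain i where i: "i \<in> J" "t = \<tau> i" using t by auto
    have "{j\<in>J. \<tau> j \<le> t} = insert i {j\<in>J. \<tau> j < t}"
      using i inj_onD[OF \<tau>_inj] by (auto simp: less_le)
    then show ?thesis using i J by (simp add: M_def)
  qed
  have M_const: "\<forall>\<^sub>F s in nhds t. M s = M t" if "t \<notin> \<tau> ` J" for t
  proof -
    have "{j\<in>J. \<tau> j \<le> t} = {j\<in>J. \<tau> j < t}" using that by (auto simp: less_le)
    then show ?thesis using M_left[of t] M_right[of t]
      by (simp add: eventually_nhds_conv_at eventually_at_split M_def)
  qed
  have M_t0: "b ^ card {j\<in>J. \<tau> j \<le> t0} = b"
  proof -
    have "{j\<in>J. \<tau> j < t0} = {}" using \<tau>_J by force
    then have "M t0 = 1" by (simp only: M_def card.empty power_0)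
    moreover have "t0 \<in> \<tau> ` J" using k0 by (auto simp: t0_def J_def)
    ultimately show ?thesis using M_jump[of t0] by simp
  qed
  have M_end: "M (t0 + T) = c"
  proof -
    have "{j\<in>J. \<tau> j < t0 + T} = J" using \<tau>_J by auto
    then show ?thesis by (simp add: M_def c_def J)
  qed
  obtain w where w: "continuous_on {t0..t0+T} w" "w t0 = c *\<^sub>R w (t0 + T)"
    and wd: "\<And>t. t \<in> {t0<..<t0+T} \<Longrightarrow> isCont M t \<Longrightarrow>
       (w has_vector_derivative
         (snd (w t), (p (t, M t *\<^sub>R w t) - g (M t * fst (w t))) / M t)) (at t)"
    by (rule sublinear_multiplier_problem[of c T M p g t0, OF c T M1 Mc p g]) blast
  \<comment> \<open>\<open>X\<close> consists of the solution and its derivative on one period, \<open>Z\<close> of their periodic extensions.\<close>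
  define X where "X = (\<lambda>t. M t *\<^sub>R w t)"
  have X_deriv: "(X has_vector_derivative (snd (X t), p (t, X t) - g (fst (X t)))) (at t)"
    if t: "t \<in> {t0<..<t0+T}" "t \<notin> \<tau> ` J" for t
  proof -
    have "isCont M t"
      using isCont_cong[OF M_const[OF t(2)]] by simp
    from bounded_linear.has_vector_derivative[OF bounded_linear_scaleR_right[of "M t"] wd[OF t(1) this]]
    have "((\<lambda>s. M t *\<^sub>R w s) has_vector_derivative (snd (X t), p (t, X t) - g (fst (X t)))) (at t)"
      using M1[of t] by (simp add: X_def)
    then show ?thesis
      unfolding has_vector_derivative_def
      by (rule has_derivative_transform_eventually)
        (use M_const[OF t(2)] in \<open>auto simp: X_def eventually_nhds_conv_at elim: eventually_mono\<close>)
  qed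
  have X_left: "(X \<longlongrightarrow> X t) (at_left t)" if "t \<in> {t0<..t0+T}" for t
  proof -
    have "(w \<longlongrightarrow> w t) (at t within {t0..t0+T})" using w(1) that by (auto simp: continuous_on_def)
    then have "(w \<longlongrightarrow> w t) (at t within {t0..t})"
      by (rule tendsto_within_subset) (use that in auto)
    then have "(w \<longlongrightarrow> w t) (at_left t)" using that by (simp add: at_within_Icc_at_left)
    from tendsto_scaleR[OF tendsto_const[of "M t"] this] show ?thesis
      unfolding X_def
      by (rule Lim_transform_eventually) (use M_left[of t] in \<open>auto elim: eventually_mono\<close>)
  qed
  have X_right: "(X \<longlongrightarrow> b ^ card {j\<in>J. \<tau> j \<le> t} *\<^sub>R w t) (at_right t)" if "t \<in> {t0..<t0+T}" for t
  proof -
    have "(w \<longlongrightarrow> w t) (at t within {t0..t0+T})" using w(1) that by (auto simp: continuous_on_def)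
    then have "(w \<longlongrightarrow> w t) (at t within {t..t0+T})"
      by (rule tendsto_within_subset) (use that in auto)
    then have "(w \<longlongrightarrow> w t) (at_right t)" using that by (simp add: at_within_Icc_at_right)
    from tendsto_scaleR[OF tendsto_const this] show ?thesis
      unfolding X_def
      by (rule Lim_transform_eventually) (use M_right[of t] in \<open>auto elim: eventually_mono\<close>)
  qed
  define Z where "Z = (\<lambda>t. X (\<phi> t))"
  have Z_left: "(Z \<longlongrightarrow> Z t) (at_left t)" for t
    unfolding Z_def \<phi>_def
    by (rule filterlim_compose[OF X_left[OF fold_into_mem[OF T]] filterlim_fold_into_left[OF T]])
  have Z_right: "(Z \<longlongrightarrow> b *\<^sub>R Z t) (at_right t)" if "t \<in> range \<tau>" for t
  proof (cases "\<phi> t = t0 + T")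
    case True
    have "(Z \<longlongrightarrow> b ^ card {j\<in>J. \<tau> j \<le> t0} *\<^sub>R w t0) (at_right t)"
      unfolding Z_def using filterlim_compose[OF X_right filterlim_fold_into_right_seam[OF T]] T True
      by (simp add: \<phi>_def)
    moreover have "b ^ card {j\<in>J. \<tau> j \<le> t0} *\<^sub>R w t0 = b *\<^sub>R Z t"
      unfolding M_t0 w(2) Z_def X_def True M_end ..
    ultimately show ?thesis by simp
  next
    case False
    then have \<phi>t: "\<phi> t \<in> {t0..<t0+T}" "\<phi> t \<in> \<tau> ` J" using \<phi>_mem[of t] \<phi>_range[of t] that by auto
    then show ?thesis
      using filterlim_compose[OF X_right[OF \<phi>t(1)] filterlim_fold_into_right[OF T, of t0 t, folded \<phi>_def]]
        M_jump[OF \<phi>t(2)]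
      by (simp add: Z_def X_def)
  qed
  have Z_deriv: "((\<lambda>s. fst (Z s)) has_real_derivative snd (Z t)) (at t)"
    "((\<lambda>s. snd (Z s)) has_real_derivative p (t, Z t) - g (fst (Z t))) (at t)" if "t \<notin> range \<tau>" for t
  proof -
    have \<phi>t: "\<phi> t \<in> {t0<..<t0+T}" "\<phi> t \<notin> \<tau> ` J" "\<phi> t < t0 + T"
      using \<phi>_mem[of t] \<phi>_range[of t] that by auto
    obtain n where n: "\<phi> t = t - T * of_int n" unfolding \<phi>_def by (rule fold_into_shift)
    have pt: "p (\<phi> t, X (\<phi> t)) = p (t, Z t)" unfolding Z_def by (subst n) (rule p_shift)
    note d = X_deriv[OF \<phi>t(1,2), unfolded pt]
    have "((\<lambda>s. fst (X s)) has_real_derivative snd (X (\<phi> t))) (at (\<phi> t))"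
      "((\<lambda>s. snd (X s)) has_real_derivative p (t, Z t) - g (fst (X (\<phi> t)))) (at (\<phi> t))"
      using bounded_linear.has_vector_derivative[OF bounded_linear_fst d]
        bounded_linear.has_vector_derivative[OF bounded_linear_snd d]
      by (simp_all add: has_real_derivative_iff_has_vector_derivative)
    from this[THEN has_real_derivative_fold_into[OF T \<phi>t(3)[unfolded \<phi>_def], folded \<phi>_def]]
    show "((\<lambda>s. fst (Z s)) has_real_derivative snd (Z t)) (at t)"
      "((\<lambda>s. snd (Z s)) has_real_derivative p (t, Z t) - g (fst (Z t))) (at t)"
      by (simp_all add: Z_def)
  qed
  show thesis
  proof (rule that)
    show "impulsive_solution \<tau> a g p (\<lambda>t. fst (Z t))"
      unfolding impulsive_solution_def
    proof (intro exI[of _ "\<lambda>t. snd (Z t)"] conjI allI impI)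
      fix t assume t: "t \<notin> range \<tau>"
      show "((\<lambda>t. fst (Z t)) has_real_derivative snd (Z t)) (at t)" by (rule Z_deriv(1)[OF t])
      show "\<exists>v'. ((\<lambda>t. snd (Z t)) has_real_derivative v') (at t) \<and>
          v' + g (fst (Z t)) = p (t, fst (Z t), snd (Z t))"
        using Z_deriv(2)[OF t] by (intro exI conjI) auto
    next
      fix j
      show "((\<lambda>t. fst (Z t)) \<longlongrightarrow> fst (Z (\<tau> j))) (at_left (\<tau> j))"
        "((\<lambda>t. snd (Z t)) \<longlongrightarrow> snd (Z (\<tau> j))) (at_left (\<tau> j))"
        by (intro tendsto_fst tendsto_snd Z_left)+
      have R: "(Z \<longlongrightarrow> b *\<^sub>R Z (\<tau> j)) (at_right (\<tau> j))" by (rule Z_right) simp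
      show "\<exists>xr vr. ((\<lambda>t. fst (Z t)) \<longlongrightarrow> xr) (at_right (\<tau> j)) \<and>
          ((\<lambda>t. snd (Z t)) \<longlongrightarrow> vr) (at_right (\<tau> j)) \<and>
          xr - fst (Z (\<tau> j)) = a * fst (Z (\<tau> j)) \<and> vr - snd (Z (\<tau> j)) = a * snd (Z (\<tau> j))"
        by (intro exI[of _ "fst (b *\<^sub>R Z (\<tau> j))"] exI[of _ "snd (b *\<^sub>R Z (\<tau> j))"] conjI
            tendsto_fst[OF R] tendsto_snd[OF R]) (simp_all add: b_def algebra_simps)
    qed
    show "fst (Z (t + T)) = fst (Z t)" for t
      using fold_into_periodic[OF T] by (simp add: Z_def \<phi>_def)
  qed
qed

theorem theorem3p1:
  fixes k0 :: nat and \<tau> :: "int \<Rightarrow> real" and a :: real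
    and p :: "real \<times> real \<times> real \<Rightarrow> real" and g :: "real \<Rightarrow> real"
  assumes "k0 \<ge> 1"
    and "0 \<le> \<tau> 1" and "strict_mono_on {1..int k0} \<tau>" and "\<tau> (int k0) < 2 * pi"
    and "\<And>j. \<tau> (j + int k0) = \<tau> j + 2 * pi"
    and "a > 0"
    and "bounded (range p)" and "continuous_on UNIV p"
    and "\<And>t x y. p (t + 2 * pi, x, y) = p (t, x, y)"
    and "local_lipschitz (UNIV :: real set) UNIV (\<lambda>_. g)"
    and "\<And>x. g differentiable (at x)"
    and g0: "((\<lambda>x. g x / x) \<longlongrightarrow> 0) at_infinity"
    and g1: "filterlim (\<lambda>x. g x * sgn x) at_top at_infinity"
      "filterlim (\<lambda>xp. LBINT s=ereal (conj_point g xp)..ereal xp.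
          1 / sqrt (primitive g xp - primitive g s)) at_top at_top"
    and g2: "\<And>x. deriv g x > 0"
  shows "\<exists>n :: nat \<Rightarrow> nat. 0 < n 0 \<and> strict_mono n \<and> filterlim n at_top sequentially \<and>
    (\<forall>k. \<exists>x. impulsive_solution \<tau> a g p x \<and> (\<forall>t. x (t + 2 * real (n k) * pi) = x t))"
proof -
  have g_cont: "continuous_on UNIV g"
    using assms(11) by (simp add: continuous_on_eq_continuous_at differentiable_imp_continuous_within)
  have "\<tau> (int k0) < \<tau> 1 + 2 * pi" using assms(2,4) by simp
  then obtain x where x: "impulsive_solution \<tau> a g p x" "\<And>t. x (t + 2 * pi) = x t"
    using exists_periodic_impulsive_solution[of k0 "2 * pi" \<tau> a p g] assms(1,3,5-9) g_cont g0
    by auto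
  have per: "x (t + 2 * real m * pi) = x t" for m t
  proof (induction m)
    case (Suc m)
    then show ?case using x(2)[of "t + 2 * real m * pi"] by (simp add: algebra_simps)
  qed simp
  show ?thesis
  proof (intro exI[of _ Suc] conjI allI exI[of _ x])
    show "strict_mono Suc" by (simp add: strict_mono_def)
    show "filterlim Suc at_top sequentially" by (rule filterlim_Suc)
    show "x (t + 2 * real (Suc k) * pi) = x t" for k t by (rule per)
  qed (use x(1) in auto)
qed

end
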